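(* Let $n$ be an integer with $n\ge 500$, let $\mathcal{S}_n$ be the symmetric group on $[n]=\{1,2,\ldots,n\}$, and let $\mathcal{F}\subset \mathcal{S}_n$ be an intersecting family. Then $$\gamma(\mathcal{F})\le (n-3)\,(n-3)!.$$
   Context: A family $\mathcal{F}\subset\mathcal{S}_n$ is called intersecting if for every $\sigma,\pi\in\mathcal{F}$ there exists $i\in[n]$ such that $\sigma(i)=\pi(i)$. For $i=1,\ldots,n$ let $X_i=\{x_{i1},\ldots,x_{in}\}$ be pairwise disjoint $n$-element sets, and let $X=X_1\cup\cdots\cup X_n$ (so $|X|=n^2$). Each permutation $\sigma\in\mathcal{S}_n$ is identified with the $n$-element set $\{x_{1\sigma(1)},x_{2\sigma(2)},\ldots,x_{n\sigma(n)}\}\subset X$, so a family of permutations is viewed as a family of $n$-subsets of $X$. The diversity of $\mathcal{F}$ is $$\gamma(\mathcal{F})=\min_{x\in X}|\{F\in\mathcal{F}: x\notin F\}|=\min_{i,j\in[n]}|\{\sigma\in\mathcal{F}:\sigma(i)\neq j\}|,$$ i.e. the minimum number of permutations in $\mathcal{F}$ whose deletion results in a star (a family of permutations all mapping some fixed $i$ to some fixed $j$). *)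

theory Defs
  imports Complex_Main "HOL-Combinatorics.Permutations"
begin

definition Sym :: "nat \<Rightarrow> (nat \<Rightarrow> nat) set" where
  "Sym n = {\<sigma>. \<sigma> permutes {1..n}}"

definition intersecting :: "nat \<Rightarrow> (nat \<Rightarrow> nat) set \<Rightarrow> bool" where
  "intersecting n \<F> \<longleftrightarrow> (\<forall>\<sigma>\<in>\<F>. \<forall>\<pi>\<in>\<F>. \<exists>i\<in>{1..n}. \<sigma> i = \<pi> i)"

text \<open>The pair \<open>(i, j)\<close> plays the role of the point \<open>x\<close> with indices \<open>i, j\<close> of the ground set;
  it lies outside the \<open>n\<close>-set identified with \<open>\<sigma>\<close> iff \<open>\<sigma> i \<noteq> j\<close>.
  \<open>Min\<close> is unspecified on the empty set, so the definition is meaningful only for \<open>n \<ge> 1\<close>.\<close>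

definition diversity :: "nat \<Rightarrow> (nat \<Rightarrow> nat) set \<Rightarrow> nat" where
  "diversity n \<F> = Min ((\<lambda>(i, j). card {\<sigma> \<in> \<F>. \<sigma> i \<noteq> j}) ` ({1..n} \<times> {1..n}))"

end

theory Submission
  imports Defs
begin

text \<open>Regard permutations as subsets of the board \<open>[n] \<times> [n]\<close> and enlarge \<open>\<F>\<close> to a maximal pairwise
  intersecting family \<open>U\<close> of partial permutations. If no subset of size at most \<open>q = n div 9\<close> of
  \<open>\<sigma> \<in> \<F>\<close> belongs to \<open>U\<close>, then by maximality each \<open>S \<subseteq> \<sigma>\<close> of at most that size is disjoint from some member
  of \<open>U\<close>, which \<open>\<sigma>\<close> must nevertheless meet. A random permutation containing \<open>S\<close> misses a given
  partial permutation with probability about \<open>1/e\<close>, so \<open>q\<close> rounds of this show that such \<open>\<sigma>\<close> are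
  exponentially rare. The remaining \<open>\<sigma>\<close> are generated by intersecting sets of size at most \<open>q\<close>. In a
  maximal intersecting family of sets of size at most \<open>l\<close> there are at most \<open>l^l\<close> minimal members of
  size \<open>l\<close>; discarding them for \<open>l = q, ..., 3\<close> costs at most \<open>54 (n - 3)!\<close> permutations. What is left is
  generated by intersecting sets of size at most \<open>2\<close>: either these share a point, and deleting few
  permutations leaves a star, or they form a triangle \<open>xyz\<close>. In the latter case either every
  member of \<open>\<F>\<close> contains two of \<open>x, y, z\<close>, which gives the exact bound, or some member avoids two
  of them, say \<open>y\<close> and \<open>z\<close>, and then only a proportion of about \<open>1 - 1/e\<close> of the permutations
  through \<open>y, z\<close> can lie in \<open>\<F>\<close>.\<close>

subsection \<open>Maximal intersecting set families\<close>

text \<open>The case \<open>A = B\<close> is included, so every member is nonempty.\<close>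

definition meeting :: "'a set set \<Rightarrow> bool" where
  "meeting U \<longleftrightarrow> (\<forall>A\<in>U. \<forall>B\<in>U. A \<inter> B \<noteq> {})"

lemma meeting_subset: "meeting U \<Longrightarrow> T \<subseteq> U \<Longrightarrow> meeting T"
  unfolding meeting_def by blast

text \<open>A set meeting every member of a maximal \<open>U\<close> could be added to it. The
  premise \<open>M \<in> U\<close> excludes an empty \<open>U\<close>, where \<open>S = {}\<close>
  can neither be added nor be disjoint from a member.\<close>

lemma maximal_meeting:
  assumes "finite P" "T \<subseteq> P" "meeting T"
  obtains U where "T \<subseteq> U" "U \<subseteq> P" "meeting U"
    "\<And>S M. S \<in> P - U \<Longrightarrow> M \<in> U \<Longrightarrow> \<exists>M\<in>U. S \<inter> M = {}"
proof -
  let ?C = "{U. T \<subseteq> U \<and> U \<subseteq> P \<and> meeting U}"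
  have "finite ?C" using assms(1) by (auto intro: finite_subset[of _ "Pow P"])
  moreover have "?C \<noteq> {}" using assms by auto
  ultimately obtain U where U: "U \<in> ?C" "\<forall>V\<in>?C. U \<subseteq> V \<longrightarrow> U = V"
    using finite_has_maximal[of ?C] by auto
  have "\<exists>M\<in>U. S \<inter> M = {}" if S: "S \<in> P - U" and M: "M \<in> U" for S M
  proof (rule ccontr)
    assume a: "\<not> ?thesis"
    then have "S \<noteq> {}" using M by auto
    with a U(1) have "meeting (insert S U)" unfolding meeting_def by (simp add: Int_commute)
    with U(1) S have "insert S U \<in> ?C" by auto
    with U(2) have "U = insert S U" by (metis subset_insertI)
    with S show False by auto
  qed
  with U that show thesis by auto
qed

text \<open>A branching count. A set \<open>S\<close> properly inside a minimal \<open>w\<close>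
  lies in \<open>P - U\<close>, hence is disjoint from some \<open>M \<in> U\<close>; every member
  containing \<open>S\<close> meets \<open>M\<close>, so it contains \<open>S\<close> and one of at
  most \<open>l\<close> further points. Building \<open>w\<close> from the empty set takes
  \<open>l\<close> such choices.\<close>

lemma card_minimal_le:
  assumes fin: "finite P" and down: "\<And>A B. A \<in> P \<Longrightarrow> B \<subseteq> A \<Longrightarrow> B \<in> P"
    and P: "\<And>A. A \<in> P \<Longrightarrow> finite A \<and> card A \<le> l"
    and U: "U \<subseteq> P" "meeting U"
    and max: "\<And>S M. S \<in> P - U \<Longrightarrow> M \<in> U \<Longrightarrow> \<exists>M\<in>U. S \<inter> M = {}"
  shows "card {w \<in> U. card w = l \<and> (\<forall>v. v \<subset> w \<longrightarrow> v \<notin> U)} \<le> l ^ l"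
proof -
  define W where "W = {w \<in> U. card w = l \<and> (\<forall>v. v \<subset> w \<longrightarrow> v \<notin> U)}"
  have finW: "finite W" unfolding W_def using fin U by (auto intro: finite_subset[of _ P])
  have "card {w \<in> W. S \<subseteq> w} \<le> l ^ k" if "card S + k = l" "finite S" for k S
    using that
  proof (induction k arbitrary: S)
    case 0
    have "{w \<in> W. S \<subseteq> w} \<subseteq> {S}"
    proof
      fix w assume "w \<in> {w \<in> W. S \<subseteq> w}"
      then have "S \<subseteq> w" "card w = l" "w \<in> P" using U unfolding W_def by auto
      moreover have "finite w" "card S = card w" using calculation 0 P by auto
      ultimately show "w \<in> {S}" using card_subset_eq by blast
    qed
    then have "card {w \<in> W. S \<subseteq> w} \<le> card {S}" by (intro card_mono) auto
    then show ?case by simp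
  next
    case (Suc k)
    show ?case
    proof (cases "{w \<in> W. S \<subseteq> w} = {}")
      case True
      then show ?thesis unfolding True by simp
    next
      case False
      then obtain w where w: "w \<in> W" "S \<subseteq> w" by auto
      then have "S \<subset> w" using Suc.prems unfolding W_def by auto
      then have "S \<in> P - U" "w \<in> U" using w U down unfolding W_def by auto
      from max[OF this] obtain M where M: "M \<in> U" "S \<inter> M = {}" by auto
      have Mf: "finite M" "card M \<le> l" using M P U by auto
      have "{w \<in> W. S \<subseteq> w} \<subseteq> (\<Union>s\<in>M. {w \<in> W. insert s S \<subseteq> w})"
      proof
        fix v assume v: "v \<in> {w \<in> W. S \<subseteq> w}"
        then have "v \<inter> M \<noteq> {}" using U(2) M(1) unfolding W_def meeting_def by auto
        with v show "v \<in> (\<Union>s\<in>M. {w \<in> W. insert s S \<subseteq> w})" by auto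
      qed
      then have "card {w \<in> W. S \<subseteq> w} \<le> card (\<Union>s\<in>M. {w \<in> W. insert s S \<subseteq> w})"
        using finW Mf by (intro card_mono) auto
      also have "\<dots> \<le> (\<Sum>s\<in>M. card {w \<in> W. insert s S \<subseteq> w})"
        using Mf by (intro card_UN_le) auto
      also have "\<dots> \<le> (\<Sum>s\<in>M. l ^ k)"
        using Suc M by (intro sum_mono Suc.IH) (auto simp: card_insert_if)
      also have "\<dots> \<le> l * l ^ k" using Mf by simp
      finally show ?thesis by simp
    qed
  qed
  from this[of "{}" l] show ?thesis unfolding W_def by simp
qed

text \<open>In a maximal extension \<open>U\<close> of \<open>T\<close>, each member contains a
  minimal one, which either has size at most \<open>l\<close> or is one of the few minimal members
  of full size collected in \<open>W\<close>.\<close>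

lemma peel_top_level:
  assumes fin: "finite P" and down: "\<And>A B. A \<in> P \<Longrightarrow> B \<subseteq> A \<Longrightarrow> B \<in> P"
    and P: "\<And>A. A \<in> P \<Longrightarrow> finite A"
    and T: "T \<subseteq> {A \<in> P. card A \<le> Suc l}" "meeting T"
  obtains T' W where "T' \<subseteq> {A \<in> P. card A \<le> l}" "meeting T'"
    "W \<subseteq> {A \<in> P. card A = Suc l}" "card W \<le> Suc l ^ Suc l"
    "\<And>A. A \<in> T \<Longrightarrow> \<exists>B\<in>T' \<union> W. B \<subseteq> A"
proof -
  let ?P = "{A \<in> P. card A \<le> Suc l}"
  have finP: "finite ?P" using fin by simp
  obtain U where U: "T \<subseteq> U" "U \<subseteq> ?P" "meeting U"
    "\<And>S M. S \<in> ?P - U \<Longrightarrow> M \<in> U \<Longrightarrow> \<exists>M\<in>U. S \<inter> M = {}"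
    by (rule maximal_meeting[OF finP T]) blast
  define W where "W = {w \<in> U. card w = Suc l \<and> (\<forall>v. v \<subset> w \<longrightarrow> v \<notin> U)}"
  define T' where "T' = {A \<in> U. card A \<le> l}"
  have "card W \<le> Suc l ^ Suc l" unfolding W_def
  proof (rule card_minimal_le[OF finP _ _ U(2,3,4)])
    show "B \<in> ?P" if "A \<in> ?P" "B \<subseteq> A" for A B
      using that down[OF _ that(2)] card_mono[OF P that(2)] by fastforce
  qed (use P in auto)
  moreover have "\<exists>B\<in>T' \<union> W. B \<subseteq> A" if "A \<in> T" for A
  proof -
    have A: "A \<in> U" "finite A" using that U P by auto
    have "finite {B \<in> U. B \<subseteq> A}" using A by (auto intro: finite_subset[of _ "Pow A"])
    moreover have "A \<in> {B \<in> U. B \<subseteq> A}" using A by auto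
    ultimately obtain B where B: "B \<in> {B \<in> U. B \<subseteq> A}" "\<forall>C\<in>{B \<in> U. B \<subseteq> A}. C \<subseteq> B \<longrightarrow> B = C"
      using finite_has_minimal[of "{B \<in> U. B \<subseteq> A}"] by (metis (no_types, lifting) empty_iff)
    then have "\<forall>v. v \<subset> B \<longrightarrow> v \<notin> U" by blast
    moreover have "card B \<le> Suc l" using B U by auto
    ultimately have "B \<in> T' \<union> W" using B unfolding T'_def W_def by auto
    then show ?thesis using B by auto
  qed
  moreover have "meeting T'" using U(3) unfolding T'_def by (auto intro: meeting_subset)
  moreover have "T' \<subseteq> {A \<in> P. card A \<le> l}" "W \<subseteq> {A \<in> P. card A = Suc l}"
    using U unfolding T'_def W_def by auto
  ultimately show thesis using that by blast
qed

text \<open>Sizes \<open>q, ..., k + 1\<close> are peeled off one at a time, each stage starting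
  from a fresh maximal extension of what the previous one left.\<close>

lemma peel_levels:
  assumes fin: "finite P" and down: "\<And>A B. A \<in> P \<Longrightarrow> B \<subseteq> A \<Longrightarrow> B \<in> P"
    and P: "\<And>A. A \<in> P \<Longrightarrow> finite A"
    and kq: "k \<le> q"
    and T: "T \<subseteq> {A \<in> P. card A \<le> q}" "meeting T"
  shows "\<exists>T' W. T' \<subseteq> {A \<in> P. card A \<le> k} \<and> meeting T' \<and>
    (\<forall>l. W l \<subseteq> {A \<in> P. card A = l} \<and> card (W l) \<le> l ^ l) \<and>
    (\<forall>A\<in>T. \<exists>B\<in>T' \<union> (\<Union>l\<in>{k<..q}. W l). B \<subseteq> A)"
  using kq T
proof (induction q arbitrary: T rule: dec_induct)
  case base
  then show ?case by (intro exI[of _ T] exI[of _ "\<lambda>_. {}"]) auto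
next
  case (step q)
  obtain T1 W1 where 1: "T1 \<subseteq> {A \<in> P. card A \<le> q}" "meeting T1"
    "W1 \<subseteq> {A \<in> P. card A = Suc q}" "card W1 \<le> Suc q ^ Suc q"
    "\<And>A. A \<in> T \<Longrightarrow> \<exists>B\<in>T1 \<union> W1. B \<subseteq> A"
    by (rule peel_top_level[OF fin down P step.prems]) blast+
  obtain T' W where 2: "T' \<subseteq> {A \<in> P. card A \<le> k}" "meeting T'"
    "\<And>l. W l \<subseteq> {A \<in> P. card A = l} \<and> card (W l) \<le> l ^ l"
    "\<And>A. A \<in> T1 \<Longrightarrow> \<exists>B\<in>T' \<union> (\<Union>l\<in>{k<..q}. W l). B \<subseteq> A"
    using step.IH[OF 1(1,2)] by meson
  let ?W = "W(Suc q := W1)"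
  have "\<exists>B\<in>T' \<union> (\<Union>l\<in>{k<..Suc q}. ?W l). B \<subseteq> A" if A: "A \<in> T" for A
  proof -
    obtain B where B: "B \<in> T1 \<union> W1" "B \<subseteq> A" using 1(5)[OF A] by auto
    show ?thesis
    proof (cases "B \<in> W1")
      case True
      then have "B \<in> (\<Union>l\<in>{k<..Suc q}. ?W l)" using step.hyps by force
      then show ?thesis using B by blast
    next
      case False
      then obtain C where C: "C \<in> T' \<union> (\<Union>l\<in>{k<..q}. W l)" "C \<subseteq> B" using 2(4) B by blast
      then have "C \<in> T' \<union> (\<Union>l\<in>{k<..Suc q}. ?W l)" by force
      then show ?thesis using B C by blast
    qed
  qed
  moreover have "?W l \<subseteq> {A \<in> P. card A = l} \<and> card (?W l) \<le> l ^ l" for l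
    using 1 2(3)[of l] by (cases "l = Suc q") auto
  ultimately show ?case using 2(1,2) by (intro exI[of _ T'] exI[of _ ?W]) auto
qed

text \<open>Pairwise intersecting edges of a graph form a star or a triangle. Smaller members cause
  no further case: the empty set is excluded, and a singleton would be a common point of all
  members. The empty family counts as \<open>point\<close>, with \<open>x\<close> arbitrary.\<close>

lemma meeting_pairs_cases:
  assumes T: "meeting T" "\<forall>A\<in>T. finite A \<and> card A \<le> 2"
  obtains (point) x where "\<And>A. A \<in> T \<Longrightarrow> x \<in> A"
  | (triangle) x y z where "x \<noteq> y" "y \<noteq> z" "x \<noteq> z" "{x, y} \<in> T" "{y, z} \<in> T" "{x, z} \<in> T"
      "T \<subseteq> {{x, y}, {y, z}, {x, z}}"
proof (cases "\<exists>x. \<forall>A\<in>T. x \<in> A")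
  case True
  then show thesis using point by auto
next
  case False
  have meet: "A \<inter> B \<noteq> {}" if "A \<in> T" "B \<in> T" for A B
    using that T(1) unfolding meeting_def by blast
  have two: "\<exists>b. b \<noteq> a \<and> A = {a, b}" if A: "A \<in> T" "a \<in> A" for A a
  proof -
    have "A \<noteq> {a}" using False A T(1) unfolding meeting_def by blast
    moreover have "card A \<noteq> 0" using A T(2) by auto
    moreover have "card A \<noteq> 1" using A calculation(1) by (metis card_1_singletonE singletonD)
    ultimately have "card A = 2" using T(2) A(1) by force
    then show ?thesis using A by (auto simp: card_2_iff)
  qed
  obtain A where A: "A \<in> T" using False by auto
  then obtain x where "x \<in> A" using T(1) unfolding meeting_def by blast
  then obtain y where y: "y \<noteq> x" "A = {x, y}" using two A by blast
  obtain B where B: "B \<in> T" "x \<notin> B" using False by auto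
  then have "y \<in> B" using meet[OF A B(1)] y by auto
  then obtain z where z: "z \<noteq> y" "B = {y, z}" using two B by blast
  obtain C where C: "C \<in> T" "y \<notin> C" using False by auto
  have "x \<in> C" "z \<in> C" using meet[OF A C(1)] meet[OF B(1) C(1)] C y z by auto
  then have Cz: "C = {x, z}" using two[OF C(1), of x] B z by auto
  have "D \<in> {{x, y}, {y, z}, {x, z}}" if D: "D \<in> T" for D
  proof -
    have m: "D \<inter> {x, y} \<noteq> {}" "D \<inter> {y, z} \<noteq> {}" "D \<inter> {x, z} \<noteq> {}"
      using meet[OF D A] meet[OF D B(1)] meet[OF D C(1)] y z Cz by auto
    then obtain a where "a \<in> D" by auto
    then obtain b where b: "D = {a, b}" using two D by blast
    have "a \<in> {x, y} \<or> b \<in> {x, y}" "a \<in> {y, z} \<or> b \<in> {y, z}" "a \<in> {x, z} \<or> b \<in> {x, z}"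
      using m unfolding b by auto
    then have "(a = x \<and> b = y) \<or> (a = y \<and> b = x) \<or> (a = y \<and> b = z) \<or> (a = z \<and> b = y)
      \<or> (a = x \<and> b = z) \<or> (a = z \<and> b = x)"
      using y(1) z(1) B(2) unfolding z(2) by auto
    then show ?thesis unfolding b by (elim disjE) (simp_all add: insert_commute)
  qed
  then have T': "T \<subseteq> {{x, y}, {y, z}, {x, z}}" by (rule subsetI)
  have "x \<noteq> z" using B(2) z by auto
  show thesis
    by (rule triangle[of x y z, OF y(1)[symmetric] z(1)[symmetric] \<open>x \<noteq> z\<close> _ _ _ T'])
      (use A B(1) C(1) y z Cz in simp_all)
qed

subsection \<open>Counting permutations through and off given points\<close>

definition pgraph :: "nat \<Rightarrow> (nat \<Rightarrow> nat) \<Rightarrow> (nat \<times> nat) set" where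
  "pgraph n \<sigma> = (\<lambda>i. (i, \<sigma> i)) ` {1..n}"

text \<open>These are the placements of non-attacking rooks on the board; defining them by
  extendability makes closure under subsets immediate.\<close>

definition partial_perms :: "nat \<Rightarrow> (nat \<times> nat) set set" where
  "partial_perms n = {S. \<exists>\<sigma>\<in>Sym n. S \<subseteq> pgraph n \<sigma>}"

definition perms_with :: "nat \<Rightarrow> (nat \<times> nat) set \<Rightarrow> (nat \<times> nat) set \<Rightarrow> (nat \<Rightarrow> nat) set" where
  "perms_with n S N = {\<sigma>\<in>Sym n. S \<subseteq> pgraph n \<sigma> \<and> pgraph n \<sigma> \<inter> N = {}}"

lemma mem_pgraph [simp]: "p \<in> pgraph n \<sigma> \<longleftrightarrow> fst p \<in> {1..n} \<and> \<sigma> (fst p) = snd p"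
  by (cases p) (auto simp: pgraph_def)

lemma finite_Sym [simp]: "finite (Sym n)"
  unfolding Sym_def by (rule finite_permutations) simp

lemma card_Sym: "card (Sym n) = fact n"
  unfolding Sym_def using card_permutations[of "{1..n}" n] by simp

lemma finite_perms_with [simp]: "finite (perms_with n S N)"
  unfolding perms_with_def by simp

lemma Sym_range: "\<sigma> \<in> Sym n \<Longrightarrow> i \<in> {1..n} \<Longrightarrow> \<sigma> i \<in> {1..n}"
  unfolding Sym_def using permutes_in_image[of \<sigma> "{1..n}" i] by auto

lemma Sym_inj: "\<sigma> \<in> Sym n \<Longrightarrow> \<sigma> i = \<sigma> j \<longleftrightarrow> i = j"
  unfolding Sym_def using permutes_inj[of \<sigma> "{1..n}"] by (auto dest: injD)

lemma partial_perms_subset_board: "S \<in> partial_perms n \<Longrightarrow> S \<subseteq> {1..n} \<times> {1..n}"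
  unfolding partial_perms_def using Sym_range by fastforce

lemma finite_partial_perms [simp]: "finite (partial_perms n)"
proof -
  have "partial_perms n \<subseteq> Pow ({1..n} \<times> {1..n})"
    using partial_perms_subset_board by blast
  then show ?thesis by (rule finite_subset) auto
qed

lemma partial_perms_subset: "A \<in> partial_perms n \<Longrightarrow> B \<subseteq> A \<Longrightarrow> B \<in> partial_perms n"
  unfolding partial_perms_def by blast

lemma partial_perms_finite: "S \<in> partial_perms n \<Longrightarrow> finite S"
  using partial_perms_subset_board finite_subset by blast

lemma pgraph_partial_perms: "\<sigma> \<in> Sym n \<Longrightarrow> pgraph n \<sigma> \<in> partial_perms n"
  unfolding partial_perms_def by blast

lemma partial_perms_inj:
  assumes "S \<in> partial_perms n"
  shows "inj_on fst S" "inj_on snd S"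
proof -
  obtain \<sigma> where \<sigma>: "\<sigma> \<in> Sym n" "S \<subseteq> pgraph n \<sigma>" using assms unfolding partial_perms_def by auto
  have *: "\<sigma> (fst p) = snd p" if "p \<in> S" for p using that \<sigma> by force
  show "inj_on fst S" by (rule inj_onI) (metis * prod_eqI)
  show "inj_on snd S" by (rule inj_onI) (metis * prod_eqI Sym_inj[OF \<sigma>(1)])
qed

text \<open>Fix one \<open>\<tau>\<close> through \<open>S\<close>. Composition with its inverse
  turns the permutations through \<open>S\<close> into those fixing every row of \<open>S\<close>,
  that is, the permutations of the remaining rows.\<close>

lemma card_perms_with:
  assumes "S \<in> partial_perms n"
  shows "card (perms_with n S {}) = fact (n - card S)"
proof -
  obtain \<tau> where \<tau>: "\<tau> \<in> Sym n" "S \<subseteq> pgraph n \<tau>" using assms unfolding partial_perms_def by auto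
  have \<tau>S: "\<tau> (fst p) = snd p" if "p \<in> S" for p using that \<tau> by force
  have perm: "\<tau> permutes {1..n}" using \<tau> unfolding Sym_def by simp
  note inv = permutes_inverses[OF perm]
  let ?R = "{1..n} - fst ` S"
  have fS: "fst ` S \<subseteq> {1..n}" using partial_perms_subset_board[OF assms] by auto
  have "bij_betw (\<lambda>\<rho>. \<tau> \<circ> \<rho>) {\<rho>. \<rho> permutes ?R} (perms_with n S {})"
  proof (rule bij_betw_byWitness[where f' = "\<lambda>\<sigma>. Hilbert_Choice.inv \<tau> \<circ> \<sigma>"])
    show "\<forall>\<rho>\<in>{\<rho>. \<rho> permutes ?R}. Hilbert_Choice.inv \<tau> \<circ> (\<tau> \<circ> \<rho>) = \<rho>" using inv by (auto simp: fun_eq_iff)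
    show "\<forall>\<sigma>\<in>perms_with n S {}. \<tau> \<circ> (Hilbert_Choice.inv \<tau> \<circ> \<sigma>) = \<sigma>" using inv by (auto simp: fun_eq_iff)
    show "(\<lambda>\<rho>. \<tau> \<circ> \<rho>) ` {\<rho>. \<rho> permutes ?R} \<subseteq> perms_with n S {}"
    proof safe
      fix \<rho> assume \<rho>: "\<rho> permutes ?R"
      then have "\<rho> permutes {1..n}" by (rule permutes_subset) auto
      then have "\<tau> \<circ> \<rho> \<in> Sym n" using perm unfolding Sym_def by (auto intro: permutes_compose)
      moreover have "p \<in> pgraph n (\<tau> \<circ> \<rho>)" if p: "p \<in> S" for p
      proof -
        have "fst p \<notin> ?R" using p by auto
        then have "\<rho> (fst p) = fst p" using permutes_not_in[OF \<rho>] by simp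
        moreover have "fst p \<in> {1..n}" using p fS by blast
        ultimately show ?thesis using \<tau>S[OF p] by simp
      qed
      ultimately show "\<tau> \<circ> \<rho> \<in> perms_with n S {}" unfolding perms_with_def by blast
    qed
    show "(\<lambda>\<sigma>. Hilbert_Choice.inv \<tau> \<circ> \<sigma>) ` perms_with n S {} \<subseteq> {\<rho>. \<rho> permutes ?R}"
    proof safe
      fix \<sigma> assume \<sigma>: "\<sigma> \<in> perms_with n S {}"
      then have "\<sigma> permutes {1..n}" unfolding perms_with_def Sym_def by simp
      then have p: "Hilbert_Choice.inv \<tau> \<circ> \<sigma> permutes {1..n}"
        by (intro permutes_compose permutes_inv perm)
      show "Hilbert_Choice.inv \<tau> \<circ> \<sigma> permutes ?R"
      proof (rule permutes_superset[OF p])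
        fix x assume "x \<in> {1..n} - ?R"
        then obtain p where p: "p \<in> S" "x = fst p" by auto
        then have "p \<in> pgraph n \<sigma>" using \<sigma> unfolding perms_with_def by blast
        then have "\<sigma> x = \<tau> x" using p \<tau>S by simp
        then show "(Hilbert_Choice.inv \<tau> \<circ> \<sigma>) x = x" using inv by simp
      qed
    qed
  qed
  then have "card (perms_with n S {}) = card {\<rho>. \<rho> permutes ?R}"
    by (simp add: bij_betw_same_card)
  also have "\<dots> = fact (card ?R)" by (rule card_permutations) auto
  also have "card ?R = n - card S"
    using fS partial_perms_inj[OF assms] by (simp add: card_Diff_subset finite_subset card_image)
  finally show ?thesis .
qed

section \<open>Switching and the probability of avoiding a partial permutation\<close>

lemma perms_with_insert_right:
  "perms_with n S (insert s N) = perms_with n S N - perms_with n (insert s S) N"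
  unfolding perms_with_def by auto

lemma perms_with_insert_left_subset: "perms_with n (insert s S) N \<subseteq> perms_with n S N"
  unfolding perms_with_def by auto

text \<open>Maximum degree at most \<open>d\<close> when \<open>N\<close> is read as a bipartite
  graph between rows and columns. Finiteness is demanded because \<open>card\<close> is 0 on
  infinite sets.\<close>

definition degree_le :: "nat \<Rightarrow> (nat \<times> nat) set \<Rightarrow> bool" where
  "degree_le d N \<longleftrightarrow> finite N \<and> (\<forall>i. card {p \<in> N. fst p = i} \<le> d \<and> card {p \<in> N. snd p = i} \<le> d)"

text \<open>Switching: composing \<open>\<pi> \<ni> (i, j)\<close> with a transposition \<open>(i i')\<close> moves \<open>\<pi>\<close> off \<open>(i, j)\<close>,
  and \<open>i' = \<pi>'\<inverse> j\<close> is recovered from the result \<open>\<pi>'\<close>; all but few \<open>i'\<close> respect \<open>S\<close> and \<open>N\<close>.\<close>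

lemma switching:
  assumes S: "finite S" and i: "i \<in> {1..n}" "i \<notin> fst ` S" and N: "degree_le d N"
  shows "(n - card S - 2 * d) * card (perms_with n (insert (i, j) S) N) \<le> card (perms_with n S N)"
proof (cases "n - card S - 2 * d = 0")
  case True
  then show ?thesis by simp
next
  case False
  let ?A = "perms_with n (insert (i, j) S) N"
  \<comment> \<open>The rows \<open>i'\<close> whose switch is safe: the new points are
    \<open>(i, \<pi> i')\<close> and \<open>(i', j)\<close>. Each of the two conditions on
    \<open>N\<close> excludes at most \<open>d\<close> rows, the first because \<open>\<pi>\<close>
    is injective.\<close>
  define J where "J \<pi> = {i'\<in>{1..n}. i' \<noteq> i \<and> i' \<notin> fst ` S \<and> (i, \<pi> i') \<notin> N \<and> (i', j) \<notin> N}" for \<pi> :: "nat \<Rightarrow> nat"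
  let ?f = "\<lambda>(\<pi>, i'). \<pi> \<circ> transpose i i'"
  have A: "\<pi> \<in> Sym n" "\<pi> i = j" "S \<subseteq> pgraph n \<pi>" "pgraph n \<pi> \<inter> N = {}" if "\<pi> \<in> ?A" for \<pi>
    using that unfolding perms_with_def by auto
  have J: "n - 1 - card S - 2 * d \<le> card (J \<pi>)" if \<pi>: "\<pi> \<in> ?A" for \<pi>
  proof -
    let ?B1 = "{i'. (i, \<pi> i') \<in> N}" and ?B2 = "{i'. (i', j) \<in> N}"
    have inj1: "inj_on (\<lambda>i'. (i, \<pi> i')) ?B1" using Sym_inj[OF A(1)[OF \<pi>]] by (auto intro: inj_onI)
    have sub1: "(\<lambda>i'. (i, \<pi> i')) ` ?B1 \<subseteq> {p \<in> N. fst p = i}" by auto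
    have inj2: "inj_on (\<lambda>i'. (i', j)) ?B2" by (auto intro: inj_onI)
    have sub2: "(\<lambda>i'. (i', j)) ` ?B2 \<subseteq> {p \<in> N. snd p = j}" by auto
    have finN: "finite {p \<in> N. fst p = i}" "finite {p \<in> N. snd p = j}" using N unfolding degree_le_def by auto
    have "card ?B1 \<le> card {p \<in> N. fst p = i}" by (rule card_inj_on_le[OF inj1 sub1 finN(1)])
    then have 1: "card ?B1 \<le> d" using N unfolding degree_le_def by (meson le_trans)
    have "card ?B2 \<le> card {p \<in> N. snd p = j}" by (rule card_inj_on_le[OF inj2 sub2 finN(2)])
    then have 2: "card ?B2 \<le> d" using N unfolding degree_le_def by (meson le_trans)
    have fin: "finite ?B1" "finite ?B2"
      using inj_on_finite[OF inj1 sub1 finN(1)] inj_on_finite[OF inj2 sub2 finN(2)] by auto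
    have "{1..n} \<subseteq> J \<pi> \<union> ({i} \<union> fst ` S \<union> ?B1 \<union> ?B2)" unfolding J_def by auto
    moreover have "finite (J \<pi>)" unfolding J_def by simp
    ultimately have "card {1..n} \<le> card (J \<pi> \<union> ({i} \<union> fst ` S \<union> ?B1 \<union> ?B2))"
      using fin S by (intro card_mono) auto
    also have "\<dots> \<le> card (J \<pi>) + card ({i} \<union> fst ` S \<union> ?B1 \<union> ?B2)" by (rule card_Un_le)
    also have "\<dots> \<le> card (J \<pi>) + (card {i} + card (fst ` S) + card ?B1 + card ?B2)"
      by (intro add_left_mono order_trans[OF card_Un_le] add_mono card_Un_le order_refl)
    also have "\<dots> \<le> card (J \<pi>) + (1 + card S + d + d)"
      using 1 2 card_image_le[OF S, of fst] by simp
    finally show ?thesis by simp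
  qed
  have inj: "inj_on ?f (Sigma ?A J)"
  proof (rule inj_onI, clarify)
    fix \<pi> a \<pi>' a' assume h: "\<pi> \<in> ?A" "\<pi>' \<in> ?A" "\<pi> \<circ> transpose i a = \<pi>' \<circ> transpose i a'"
    have "(\<pi> \<circ> transpose i a) a = j" using A(2)[OF h(1)] by simp
    moreover have "(\<pi>' \<circ> transpose i a') a' = j" using A(2)[OF h(2)] by simp
    ultimately have "(\<pi> \<circ> transpose i a) a = (\<pi> \<circ> transpose i a) a'" using h(3) by simp
    then have "transpose i a a = transpose i a a'" using Sym_inj[OF A(1)[OF h(1)]] by simp
    then have e: "a = a'" by (metis transpose_involutory)
    have "\<pi> \<circ> transpose i a \<circ> transpose i a = \<pi>' \<circ> transpose i a \<circ> transpose i a" using h(3) e by simp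
    then have "\<pi> = \<pi>'" by (simp add: comp_assoc)
    with e show "\<pi> = \<pi>' \<and> a = a'" by simp
  qed
  have img: "?f ` Sigma ?A J \<subseteq> perms_with n S (insert (i, j) N)"
  proof (rule image_subsetI, clarify)
    fix \<pi> a assume h: "\<pi> \<in> ?A" "a \<in> J \<pi>"
    let ?\<rho> = "\<pi> \<circ> transpose i a"
    note \<pi> = A[OF h(1)]
    have a: "a \<in> {1..n}" "a \<noteq> i" "a \<notin> fst ` S" "(i, \<pi> a) \<notin> N" "(a, j) \<notin> N" using h(2) unfolding J_def by auto
    have "?\<rho> \<in> Sym n" using \<pi>(1) permutes_compose[OF permutes_swap_id[OF i(1) a(1)]]
      unfolding Sym_def by simp
    moreover have "S \<subseteq> pgraph n ?\<rho>"
    proof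
      fix p assume p: "p \<in> S"
      then have "fst p \<noteq> i" "fst p \<noteq> a" using i(2) a(3) by auto
      moreover have "p \<in> pgraph n \<pi>" using p \<pi>(3) by blast
      ultimately show "p \<in> pgraph n ?\<rho>" by simp
    qed
    moreover have "p \<notin> insert (i, j) N" if p: "p \<in> pgraph n ?\<rho>" for p
    proof -
      consider "fst p = i" | "fst p = a" | "fst p \<noteq> i" "fst p \<noteq> a" by auto
      then show ?thesis
      proof cases
        case 1
        then have "p = (i, \<pi> a)" using p by (auto intro: prod_eqI)
        moreover have "\<pi> a \<noteq> j" using Sym_inj[OF \<pi>(1), of a i] \<pi>(2) a(2) by simp
        ultimately show ?thesis using a by simp
      next
        case 2
        then have "p = (a, j)" using p \<pi>(2) by (auto intro: prod_eqI)
        then show ?thesis using a by simp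
      next
        case 3
        then have "p \<in> pgraph n \<pi>" using p by simp
        then show ?thesis using 3 \<pi>(4) by auto
      qed
    qed
    ultimately show "?\<rho> \<in> perms_with n S (insert (i, j) N)" unfolding perms_with_def by blast
  qed
  have fJ: "\<forall>\<pi>\<in>?A. finite (J \<pi>)" unfolding J_def by simp
  have "(n - 1 - card S - 2 * d) * card ?A = (\<Sum>\<pi>\<in>?A. n - 1 - card S - 2 * d)" by simp
  also have "\<dots> \<le> (\<Sum>\<pi>\<in>?A. card (J \<pi>))" by (intro sum_mono J)
  also have "\<dots> = card (Sigma ?A J)" by (rule card_SigmaI[symmetric, OF finite_perms_with fJ])
  also have "\<dots> \<le> card (perms_with n S (insert (i, j) N))"
    by (rule card_inj_on_le[OF inj img finite_perms_with])
  also have "\<dots> = card (perms_with n S N) - card ?A"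
    unfolding perms_with_insert_right
    by (intro card_Diff_subset finite_perms_with perms_with_insert_left_subset)
  finally have "(n - 1 - card S - 2 * d) * card ?A \<le> card (perms_with n S N) - card ?A" .
  moreover have "card ?A \<le> card (perms_with n S N)"
    by (intro card_mono finite_perms_with perms_with_insert_left_subset)
  \<comment> \<open>The row \<open>i\<close> itself, lost in counting switches, is regained by
    moving \<open>card ?A\<close> to the left-hand side. Subtraction being truncated, this needs the
    nonzero case.\<close>
  moreover have "n - card S - 2 * d = Suc (n - 1 - card S - 2 * d)" using False by simp
  ultimately show ?thesis by simp
qed

text \<open>Forbid the points of \<open>M\<close> one by one. By switching, each new point lies on
  at most a fraction \<open>1 / k\<close> of the permutations still left; the degree bound for
  \<open>N \<union> M\<close> covers all intermediate sets.\<close>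

lemma card_avoid_ge:
  assumes S: "finite S" and M: "finite M" "fst ` M \<subseteq> {1..n} - fst ` S"
    and N: "degree_le d (N \<union> M)" and k: "0 < k" "k \<le> n - card S - 2 * d"
  shows "(1 - 1 / real k) ^ card M * card (perms_with n S N) \<le> card (perms_with n S (N \<union> M))"
  using M N
proof (induction M rule: finite_induct)
  case empty
  then show ?case by simp
next
  case (insert s M)
  let ?p = "1 - 1 / real k"
  let ?a = "card (perms_with n (Set.insert s S) (N \<union> M))" and ?b = "card (perms_with n S (N \<union> M))"
  have deg: "degree_le d (N \<union> M)"
    unfolding degree_le_def
  proof (intro conjI allI)
    have fin: "finite (N \<union> Set.insert s M)" using insert.prems unfolding degree_le_def by auto
    then show "finite (N \<union> M)" by auto
    fix i
    have "card {p \<in> N \<union> M. fst p = i} \<le> card {p \<in> N \<union> Set.insert s M. fst p = i}"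
      "card {p \<in> N \<union> M. snd p = i} \<le> card {p \<in> N \<union> Set.insert s M. snd p = i}"
      using fin by (auto intro!: card_mono)
    then show "card {p \<in> N \<union> M. fst p = i} \<le> d" "card {p \<in> N \<union> M. snd p = i} \<le> d"
      using insert.prems unfolding degree_le_def by (meson le_trans)+
  qed
  obtain i j where s: "s = (i, j)" by (cases s)
  have i: "i \<in> {1..n}" "i \<notin> fst ` S" using insert.prems s by auto
  have "k * ?a \<le> (n - card S - 2 * d) * ?a" using k by (intro mult_right_mono) auto
  also have "\<dots> \<le> ?b" unfolding s by (rule switching[OF S i deg])
  finally have "real k * real ?a \<le> real ?b" by (metis of_nat_le_iff of_nat_mult)
  then have a: "real ?a \<le> real ?b / real k" using k by (simp add: field_simps)
  have ab: "?a \<le> ?b" by (intro card_mono finite_perms_with perms_with_insert_left_subset)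
  have "?p ^ card (Set.insert s M) * card (perms_with n S N) = ?p * (?p ^ card M * card (perms_with n S N))"
    using insert.hyps by simp
  also have "\<dots> \<le> ?p * ?b" using k insert deg by (intro mult_left_mono) auto
  also have "\<dots> = ?b - ?b / real k" using k by (simp add: field_simps)
  also have "\<dots> \<le> real ?b - real ?a" using a by simp
  also have "\<dots> = real (?b - ?a)" using ab by simp
  also have "?b - ?a = card (perms_with n S (N \<union> Set.insert s M))"
    unfolding Un_insert_right perms_with_insert_right
    by (intro card_Diff_subset[symmetric] finite_perms_with perms_with_insert_left_subset)
  finally show ?case .
qed

text \<open>Here \<open>1 - 1/k \<ge> exp (- 1/(k - 1))\<close>, and the hypotheses give
  \<open>m/(k - 1) \<le> (4/3) * (81/80) = 27/20\<close>. Finally \<open>exp (- 27/20)\<close> is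
  bounded below by the rational \<open>(99/100) ^ 135\<close>, which exceeds
  \<open>1/4\<close>.\<close>

lemma power_one_minus_inverse_ge:
  assumes "81 \<le> k" "3 * m \<le> 4 * k"
  shows "1 / 4 \<le> (1 - 1 / real k) ^ m"
proof -
  let ?t = "1 / (real k - 1)"
  have k: "real k - 1 > 0" using assms by simp
  have "1 - 1 / real k = inverse (1 + ?t)" using k by (simp add: field_simps)
  also have "\<dots> \<ge> inverse (exp ?t)" using k exp_ge_add_one_self[of ?t]
    by (intro le_imp_inverse_le) (auto intro: add_pos_pos)
  finally have "exp (- ?t) \<le> 1 - 1 / real k" by (simp add: exp_minus)
  then have "exp (- ?t) ^ m \<le> (1 - 1 / real k) ^ m" by (intro power_mono) auto
  moreover have "exp (- ?t) ^ m = exp (- (real m * ?t))" by (simp flip: exp_of_nat_mult)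
  moreover have "exp (- (27 / 20)) \<le> exp (- (real m * ?t))"
  proof -
    have "81 \<le> real k" "3 * real m \<le> 4 * real k" using assms by simp_all
    then have "60 * real m \<le> 81 * (real k - 1)" by argo
    then have "real m * ?t \<le> 27 / 20" using k by (simp add: field_simps)
    then show ?thesis by simp
  qed
  moreover have "1 / 4 \<le> exp (- (27 / 20 :: real))"
  proof -
    have "(1 / 4 :: real) \<le> (99 / 100) ^ 135" by (simp add: field_simps)
    also have "\<dots> \<le> exp (- (1 / 100)) ^ 135"
      using exp_ge_add_one_self[of "- (1 / 100) :: real"] by (intro power_mono) auto
    also have "\<dots> = exp (- (27 / 20))" by (simp flip: exp_of_nat_mult)
    finally show ?thesis .
  qed
  ultimately show ?thesis by linarith
qed

text \<open>A partial permutation has at most one point in each row and column. Subsets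
  \<open>L\<close> are allowed since only part of \<open>M\<close> may have been queried.\<close>

lemma degree_le_Un:
  assumes N: "degree_le d N" and M: "M \<in> partial_perms n" and L: "L \<subseteq> N \<union> M"
  shows "degree_le (Suc d) L"
proof -
  have fin: "finite N" "finite M" using N partial_perms_finite[OF M] unfolding degree_le_def by auto
  have inj: "card {p \<in> M. f p = i} \<le> 1" if "inj_on f M" for f :: "nat \<times> nat \<Rightarrow> nat" and i
    unfolding One_nat_def using inj_onD[OF that] fin by (subst card_le_Suc0_iff_eq) auto
  have "card {p \<in> L. f p = i} \<le> Suc d"
    if "inj_on f M" "card {p \<in> N. f p = i} \<le> d" for f :: "nat \<times> nat \<Rightarrow> nat" and i
  proof -
    have "card {p \<in> L. f p = i} \<le> card ({p \<in> N. f p = i} \<union> {p \<in> M. f p = i})"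
      using fin L by (intro card_mono) auto
    also have "\<dots> \<le> card {p \<in> N. f p = i} + card {p \<in> M. f p = i}" by (rule card_Un_le)
    finally show ?thesis using inj[OF that(1), of i] that(2) by simp
  qed
  then show ?thesis using N partial_perms_inj[OF M] fin finite_subset[OF L]
    unfolding degree_le_def by simp
qed

text \<open>A point of \<open>M\<close> in a row of \<open>S\<close> lies on no permutation through
  \<open>S\<close>, because \<open>S\<close> and \<open>M\<close> are disjoint. So only
  \<open>M'\<close> can be hit, and it is avoided with probability at least
  \<open>1/4\<close>.\<close>

lemma card_hit_le:
  assumes n: "500 \<le> n" and q: "9 * q \<le> n" "card S \<le> q" "Suc d \<le> q"
    and S: "S \<in> partial_perms n" and M: "M \<in> partial_perms n" "S \<inter> M = {}"
    and N: "degree_le d N"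
  shows "4 * card {\<pi> \<in> perms_with n S N. pgraph n \<pi> \<inter> M \<noteq> {}} \<le> 3 * card (perms_with n S N)"
proof -
  define M' where "M' = {p \<in> M. fst p \<notin> fst ` S}"
  define k where "k = n - card S - 2 * Suc d"
  have fM: "finite M" "fst ` M \<subseteq> {1..n}"
    using partial_perms_finite[OF M(1)] partial_perms_subset_board[OF M(1)] by auto
  have fS: "finite S" "fst ` S \<subseteq> {1..n}"
    using partial_perms_finite[OF S] partial_perms_subset_board[OF S] by auto
  have M': "finite M'" "fst ` M' \<subseteq> {1..n} - fst ` S" using fM unfolding M'_def by auto
  have "card M' = card (fst ` M')"
    using partial_perms_inj(1)[OF M(1)] by (intro card_image[symmetric]) (auto simp: M'_def inj_on_def)
  also have "\<dots> \<le> card ({1..n} - fst ` S)" using M' by (intro card_mono) auto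
  also have "\<dots> = n - card S"
    using fS partial_perms_inj(1)[OF S] by (simp add: card_Diff_subset card_image)
  finally have cM': "card M' \<le> n - card S" .
  have "k + 2 * Suc d + card S = n" "card M' \<le> k + 2 * Suc d" using q cM' unfolding k_def by auto
  \<comment> \<open>Since \<open>card S\<close> and \<open>Suc d\<close> are at most
    \<open>q\<close> and \<open>9 * q \<le> n\<close>, one has \<open>k \<ge> 6 * q\<close>, so
    \<open>2 * Suc d\<close> is at most a third of \<open>k\<close>.\<close>
  then have k: "81 \<le> k" "3 * card M' \<le> 4 * k" using n q by simp_all
  have "real (card (perms_with n S N)) / 4 \<le> (1 - 1 / real k) ^ card M' * card (perms_with n S N)"
    using mult_right_mono[OF power_one_minus_inverse_ge[OF k]] by simp
  also have "\<dots> \<le> card (perms_with n S (N \<union> M'))"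
    using k by (intro card_avoid_ge[where d = "Suc d"] fS M' degree_le_Un[OF N M(1)]) (auto simp: M'_def k_def)
  finally have "card (perms_with n S N) \<le> 4 * card (perms_with n S (N \<union> M'))" by linarith
  moreover have "perms_with n S (N \<union> M') =
    perms_with n S N - {\<pi> \<in> perms_with n S N. pgraph n \<pi> \<inter> M \<noteq> {}}"
  proof -
    have "p \<in> M'" if "\<pi> \<in> perms_with n S N" "p \<in> M" "p \<in> pgraph n \<pi>" for \<pi> p
    proof (rule ccontr)
      assume "p \<notin> M'"
      then have "fst p \<in> fst ` S" using that(2) unfolding M'_def by simp
      then obtain r where r: "r \<in> S" "fst p = fst r" by blast
      then have "r \<in> pgraph n \<pi>" using that unfolding perms_with_def by blast
      then have "p = r" using r that by (auto intro: prod_eqI)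
      then show False using r that M by auto
    qed
    moreover have "M' \<subseteq> M" unfolding M'_def by auto
    ultimately show ?thesis unfolding perms_with_def by blast
  qed
  moreover have "card (perms_with n S N - {\<pi> \<in> perms_with n S N. pgraph n \<pi> \<inter> M \<noteq> {}}) =
      card (perms_with n S N) - card {\<pi> \<in> perms_with n S N. pgraph n \<pi> \<inter> M \<noteq> {}}"
    by (intro card_Diff_subset) auto
  moreover have "card {\<pi> \<in> perms_with n S N. pgraph n \<pi> \<inter> M \<noteq> {}} \<le> card (perms_with n S N)"
    by (intro card_mono) auto
  ultimately show ?thesis by simp
qed

text \<open>Reveal \<open>\<sigma>\<close> point by point: as long as the known part \<open>S \<subseteq> \<sigma>\<close> has at most \<open>q\<close> points,
  query the points of some \<open>M \<in> U\<close> disjoint from \<open>S\<close> until one lies in \<open>\<sigma>\<close>; the set \<open>N\<close> records the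
  failed queries. Each of the \<open>q\<close> rounds succeeds with conditional probability at most \<open>3/4\<close>.\<close>

lemma decision_tree:
  assumes n: "500 \<le> n" "9 * q \<le> n" and B: "B \<subseteq> Sym n" and U: "U \<subseteq> partial_perms n"
    and query: "\<And>\<sigma> S. \<sigma> \<in> B \<Longrightarrow> S \<subseteq> pgraph n \<sigma> \<Longrightarrow> card S \<le> q \<Longrightarrow> \<exists>M\<in>U. S \<inter> M = {}"
    and hit: "\<And>\<sigma> M. \<sigma> \<in> B \<Longrightarrow> M \<in> U \<Longrightarrow> pgraph n \<sigma> \<inter> M \<noteq> {}"
  assumes "finite S" "card S + k = q" "degree_le (card S) N"
  shows "4 ^ k * card (B \<inter> perms_with n S N) \<le> 3 ^ k * card (perms_with n S N)"
  using assms(7-9)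
proof (induction k arbitrary: S N)
  case 0
  then show ?case by (simp add: card_mono)
next
  case (Suc k)
  show ?case
  proof (cases "B \<inter> perms_with n S N = {}")
    case True
    then show ?thesis unfolding True by simp
  next
    case False
    then obtain \<sigma> where \<sigma>: "\<sigma> \<in> B" "\<sigma> \<in> Sym n" "S \<subseteq> pgraph n \<sigma>" unfolding perms_with_def by auto
    then obtain M where M: "M \<in> U" "S \<inter> M = {}" using query[of \<sigma> S] Suc.prems by auto
    have MP: "M \<in> partial_perms n" using M U by auto
    define H where "H M' = {\<pi> \<in> perms_with n S N. pgraph n \<pi> \<inter> M' \<noteq> {}}" for M'
    have H: "4 ^ k * card (B \<inter> H M') \<le> 3 ^ k * card (H M')" if "finite M'" "M' \<subseteq> M" for M'
      using that
    proof (induction M' rule: finite_induct)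
      case empty
      then show ?case unfolding H_def by simp
    next
      case (insert s M')
      let ?P = "perms_with n (Set.insert s S) (N \<union> M')"
      \<comment> \<open>Split by the first point of \<open>M\<close> that is hit: the permutations
        newly counted contain \<open>s\<close> and avoid all points queried before it.\<close>
      have H: "H (Set.insert s M') = H M' \<union> ?P" "H M' \<inter> ?P = {}"
        unfolding H_def perms_with_def by auto
      have fin: "finite (H M')" unfolding H_def by simp
      have s: "s \<notin> S" using insert.prems M by auto
      have "4 ^ k * card (B \<inter> ?P) \<le> 3 ^ k * card ?P"
      proof (rule Suc.IH)
        \<comment> \<open>A round adds one point to \<open>S\<close> and at most one to each row and
          column of \<open>N\<close>, so \<open>card S\<close> keeps bounding the degree of
          \<open>N\<close>.\<close>
        show "degree_le (card (Set.insert s S)) (N \<union> M')"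
          using s Suc.prems insert.prems by (auto intro!: degree_le_Un[OF _ MP])
      qed (use s Suc.prems in auto)
      moreover have "card (B \<inter> H (Set.insert s M')) = card (B \<inter> H M') + card (B \<inter> ?P)"
        unfolding H(1) Int_Un_distrib using H(2) fin by (intro card_Un_disjoint) auto
      moreover have "card (H (Set.insert s M')) = card (H M') + card ?P"
        unfolding H(1) using H(2) fin by (intro card_Un_disjoint) auto
      ultimately show ?case using insert by (simp add: algebra_simps)
    qed
    \<comment> \<open>Members of \<open>B\<close> must meet \<open>M\<close>. Hence nothing of
      \<open>B\<close> is lost in restricting to \<open>H M\<close>, whereas at most
      \<open>3/4\<close> of all permutations remain.\<close>
    have "B \<inter> perms_with n S N = B \<inter> H M" using hit M unfolding H_def by auto
    then have "4 ^ Suc k * card (B \<inter> perms_with n S N) = 4 * (4 ^ k * card (B \<inter> H M))" by simp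
    also have "\<dots> \<le> 4 * (3 ^ k * card (H M))"
      using H[OF partial_perms_finite[OF MP]] by (intro mult_left_mono) auto
    also have "\<dots> = 3 ^ k * (4 * card (H M))" by simp
    also have "\<dots> \<le> 3 ^ k * (3 * card (perms_with n S N))"
      unfolding H_def using \<sigma> Suc.prems n M
      by (intro mult_left_mono card_hit_le[OF n(1) n(2) _ _ _ MP]) (auto simp: partial_perms_def)
    finally show ?thesis by simp
  qed
qed

section \<open>Numerical estimates\<close>

lemma exponential_beats_quadratic:
  assumes "55 \<le> q"
  shows "20 * 3 ^ q * (9 * q + 8)\<^sup>2 \<le> (4::nat) ^ q"
  using assms
proof (induction q rule: dec_induct)
  case base
  then show ?case by simp
next
  case (step q)
  have "3 * (9 * Suc q + 8)\<^sup>2 \<le> 4 * (9 * q + 8)\<^sup>2"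
  proof -
    have "4455 * q \<le> 81 * (q * q)" using step by simp
    then have "611 + 342 * q \<le> 81 * (q * q)" using step(1) by linarith
    then show ?thesis by (simp add: power2_eq_square algebra_simps)
  qed
  then have "20 * 3 ^ q * (3 * (9 * Suc q + 8)\<^sup>2) \<le> 20 * 3 ^ q * (4 * (9 * q + 8)\<^sup>2)"
    by (intro mult_left_mono) auto
  also have "\<dots> = 4 * (20 * 3 ^ q * (9 * q + 8)\<^sup>2)" by simp
  also have "\<dots> \<le> 4 * 4 ^ q" using step by (intro mult_left_mono) auto
  finally show ?case by (simp add: algebra_simps)
qed

text \<open>For positive \<open>l\<close> this is
  \<open>(1 + 1/l) ^ l \<le> exp 1 \<le> 3\<close>.\<close>

lemma Suc_power_self_le: "Suc l ^ l \<le> 3 * l ^ l"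
proof (cases "l = 0")
  case False
  have "(1 + 1 / real l) ^ l \<le> exp (1 / real l) ^ l"
    by (intro power_mono) auto
  also have "\<dots> = exp 1" using False by (simp flip: exp_of_nat_mult)
  also have "\<dots> \<le> 3" by (rule exp_le)
  finally have "((real l + 1) / real l) ^ l \<le> 3" using False by (simp add: field_simps)
  then have "(real l + 1) ^ l \<le> 3 * real l ^ l" using False by (simp add: power_divide field_simps)
  then have "real (Suc l ^ l) \<le> real (3 * l ^ l)" by (simp add: add.commute)
  then show ?thesis by linarith
qed simp

text \<open>Each term is at most half the previous one, since \<open>n - l \<ge> 6 * Suc l\<close>.
  Counting the last term twice therefore makes the left-hand side nonincreasing in \<open>l\<close>;
  at \<open>l = 3\<close> it is \<open>(27 + 27) * fact (n - 3)\<close>.\<close>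

lemma sum_minimal_le:
  assumes "3 \<le> l" "l \<le> q" "9 * q \<le> n"
  shows "(\<Sum>i\<in>{2<..l}. i ^ i * fact (n - i)) + l ^ l * fact (n - l) \<le> 54 * (fact (n - 3) :: nat)"
  using assms
proof (induction l rule: dec_induct)
  case base
  have "{2<..3::nat} = {3}" by auto
  then show ?case by simp
next
  case (step l)
  have "{2<..Suc l} = insert (Suc l) {2<..l}" using step by auto
  then have s: "(\<Sum>i\<in>{2<..Suc l}. i ^ i * fact (n - i)) =
    (\<Sum>i\<in>{2<..l}. i ^ i * fact (n - i)) + Suc l ^ Suc l * (fact (n - Suc l) :: nat)" by simp
  have f: "(fact (n - l) :: nat) = (n - l) * fact (n - Suc l)"
    using step by (subst fact_reduce) auto
  have "2 * (Suc l ^ Suc l * fact (n - Suc l)) = 2 * Suc l * (Suc l ^ l * (fact (n - Suc l) :: nat))"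
    by (simp only: power_Suc mult.assoc)
  also have "\<dots> \<le> 2 * Suc l * (3 * l ^ l * fact (n - Suc l))"
    by (intro mult_left_mono mult_right_mono Suc_power_self_le) auto
  also have "\<dots> = 6 * Suc l * (l ^ l * fact (n - Suc l))" by (simp only: mult_ac)
  also have "\<dots> \<le> (n - l) * (l ^ l * fact (n - Suc l))"
    using step by (intro mult_right_mono) auto
  finally have "2 * (Suc l ^ Suc l * fact (n - Suc l)) \<le> l ^ l * (fact (n - l) :: nat)"
    unfolding f by (simp only: mult_ac)
  then show ?case using step unfolding s by linarith
qed

subsection \<open>Generating sets of size at most two\<close>

text \<open>The exceptional set \<open>E\<close> collects the members without a generator of size at
  most \<open>q\<close>, bounded by the decision tree, and the members through a peeled-off set,
  bounded by \<open>sum_minimal_le\<close>.\<close>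

lemma two_element_core:
  assumes n: "500 \<le> n" and F: "F \<subseteq> Sym n" and meet: "meeting (pgraph n ` F)"
  obtains T E where "T \<subseteq> partial_perms n" "\<And>A. A \<in> T \<Longrightarrow> card A \<le> 2" "meeting T"
    "E \<subseteq> F" "5 * card E \<le> fact (n - 2)" "\<And>\<sigma>. \<sigma> \<in> F - E \<Longrightarrow> \<exists>A\<in>T. A \<subseteq> pgraph n \<sigma>"
proof (cases "F = {}")
  case True
  then show thesis using that[of "{}" "{}"] unfolding meeting_def by simp
next
  case False
  define q where "q = n div 9"
  have q: "9 * q \<le> n" "n \<le> 9 * q + 8" "55 \<le> q" using n unfolding q_def by auto
  have "pgraph n ` F \<subseteq> partial_perms n" using F pgraph_partial_perms unfolding partial_perms_def by blast
  then obtain U where U: "pgraph n ` F \<subseteq> U" "U \<subseteq> partial_perms n" "meeting U"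
    "\<And>S M. S \<in> partial_perms n - U \<Longrightarrow> M \<in> U \<Longrightarrow> \<exists>M\<in>U. S \<inter> M = {}"
    using maximal_meeting[OF finite_partial_perms _ meet] by metis
  \<comment> \<open>A member of \<open>F\<close> supplies the member of \<open>U\<close> that the
    maximality property asks for.\<close>
  obtain \<sigma>0 where \<sigma>0: "\<sigma>0 \<in> F" using False by auto
  define B where "B = {\<sigma>\<in>F. \<forall>A\<in>U. A \<subseteq> pgraph n \<sigma> \<longrightarrow> q < card A}"
  have BS: "B \<subseteq> Sym n" using F unfolding B_def by auto
  have "4 ^ q * card (B \<inter> perms_with n {} {}) \<le> 3 ^ q * card (perms_with n {} {})"
  proof (rule decision_tree[OF n q(1) BS U(2)])
    fix \<sigma> S assume h: "\<sigma> \<in> B" "S \<subseteq> pgraph n \<sigma>" "card S \<le> q"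
    then have "S \<in> partial_perms n - U" using BS unfolding B_def partial_perms_def by auto
    then show "\<exists>M\<in>U. S \<inter> M = {}" using U(1) \<sigma>0 by (intro U(4)) auto
  next
    fix \<sigma> M assume "\<sigma> \<in> B" "M \<in> U"
    then show "pgraph n \<sigma> \<inter> M \<noteq> {}" using U(1,3) unfolding B_def meeting_def by auto
  qed (auto simp: degree_le_def)
  moreover have "perms_with n {} {} = Sym n" unfolding perms_with_def by simp
  ultimately have cB: "4 ^ q * card B \<le> 3 ^ q * (fact n :: nat)"
    using BS by (simp add: card_Sym Int_absorb2)
  have fact_n: "(fact n :: nat) = n * ((n - 1) * fact (n - 2))"
  proof -
    have "(fact n :: nat) = n * fact (n - 1)" using n by (subst fact_reduce) auto
    moreover have "(fact (n - 1) :: nat) = (n - 1) * fact (n - 1 - 1)" using n by (subst fact_reduce) auto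
    ultimately show ?thesis by (simp add: numeral_2_eq_2)
  qed
  have "20 * card B \<le> (fact (n - 2) :: nat)"
  proof -
    have "n * (n - 1) \<le> (9 * q + 8)\<^sup>2"
      using q(2) unfolding power2_eq_square by (intro mult_mono) auto
    then have "20 * 3 ^ q * (n * (n - 1)) \<le> 20 * 3 ^ q * (9 * q + 8)\<^sup>2"
      by (intro mult_left_mono) auto
    then have e: "20 * 3 ^ q * (n * (n - 1)) \<le> (4::nat) ^ q"
      using exponential_beats_quadratic[OF q(3)] by linarith
    have "4 ^ q * (20 * card B) = 20 * (4 ^ q * card B)" by simp
    also have "\<dots> \<le> 20 * (3 ^ q * (n * ((n - 1) * fact (n - 2))))"
      using cB unfolding fact_n by (intro mult_left_mono) auto
    also have "\<dots> = 20 * 3 ^ q * (n * (n - 1)) * fact (n - 2)" by (simp only: mult.assoc)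
    also have "\<dots> \<le> 4 ^ q * fact (n - 2)" using e by (intro mult_right_mono) auto
    finally show ?thesis by simp
  qed
  have "2 \<le> q" using q by simp
  have TU: "{A \<in> U. card A \<le> q} \<subseteq> {A \<in> partial_perms n. card A \<le> q}" "meeting {A \<in> U. card A \<le> q}"
    using U(2) meeting_subset[OF U(3)] by auto
  have "\<exists>T W. T \<subseteq> {A \<in> partial_perms n. card A \<le> 2} \<and> meeting T \<and>
    (\<forall>l. W l \<subseteq> {A \<in> partial_perms n. card A = l} \<and> card (W l) \<le> l ^ l) \<and>
    (\<forall>A\<in>{A \<in> U. card A \<le> q}. \<exists>B\<in>T \<union> (\<Union>l\<in>{2<..q}. W l). B \<subseteq> A)"
    by (rule peel_levels[OF finite_partial_perms _ _ \<open>2 \<le> q\<close> TU])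
      (rule partial_perms_subset partial_perms_finite, assumption+)+
  then obtain T W where "T \<subseteq> {A \<in> partial_perms n. card A \<le> 2} \<and> meeting T \<and>
    (\<forall>l. W l \<subseteq> {A \<in> partial_perms n. card A = l} \<and> card (W l) \<le> l ^ l) \<and>
    (\<forall>A\<in>{A \<in> U. card A \<le> q}. \<exists>B\<in>T \<union> (\<Union>l\<in>{2<..q}. W l). B \<subseteq> A)"
    by (elim exE) (rule that)
  then have TW: "T \<subseteq> {A \<in> partial_perms n. card A \<le> 2}" "meeting T"
    "W l \<subseteq> {A \<in> partial_perms n. card A = l} \<and> card (W l) \<le> l ^ l"
    "\<forall>A\<in>{A \<in> U. card A \<le> q}. \<exists>B\<in>T \<union> (\<Union>l\<in>{2<..q}. W l). B \<subseteq> A" for l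
    by simp_all
  define V where "V = (\<Union>l\<in>{2<..q}. \<Union>A\<in>W l. perms_with n A {})"
  have finW: "finite (W l)" for l
    using TW(3)[of l] by (auto intro: finite_subset[OF _ finite_partial_perms])
  have "card V \<le> (\<Sum>l\<in>{2<..q}. card (\<Union>A\<in>W l. perms_with n A {}))"
    unfolding V_def by (intro card_UN_le) auto
  also have "\<dots> \<le> (\<Sum>l\<in>{2<..q}. \<Sum>A\<in>W l. card (perms_with n A {}))"
    by (intro sum_mono card_UN_le finW)
  also have "\<dots> = (\<Sum>l\<in>{2<..q}. \<Sum>A\<in>W l. fact (n - l))"
    by (intro sum.cong refl) (use TW(3) card_perms_with in blast)
  also have "\<dots> \<le> (\<Sum>l\<in>{2<..q}. l ^ l * fact (n - l))"
    using TW(3) by (intro sum_mono) simp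
  also have "\<dots> \<le> 54 * fact (n - 3)" using sum_minimal_le[of q q n] q by simp
  finally have cV: "card V \<le> 54 * fact (n - 3)" .
  have finV: "finite V" unfolding V_def using finW by auto
  define E where "E = B \<union> F \<inter> V"
  have "card E \<le> card B + card V"
    unfolding E_def using finV by (intro order_trans[OF card_Un_le] add_mono card_mono order_refl) auto
  moreover have "(fact (n - 2) :: nat) = (n - 2) * fact (n - 3)"
  proof -
    have "(fact (n - 2) :: nat) = (n - 2) * fact (n - 2 - 1)" using n by (subst fact_reduce) auto
    then show ?thesis by (simp add: numeral_eq_Suc)
  qed
  \<comment> \<open>The total loss is at most \<open>1/20 + 54/498 < 1/5\<close> of
    \<open>fact (n - 2)\<close>.\<close>
  moreover have "498 * fact (n - 3) \<le> (n - 2) * (fact (n - 3) :: nat)"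
    using n by (intro mult_right_mono) auto
  ultimately have cE: "5 * card E \<le> fact (n - 2)"
    using cV \<open>20 * card B \<le> fact (n - 2)\<close> by linarith
  have "\<exists>A\<in>T. A \<subseteq> pgraph n \<sigma>" if \<sigma>: "\<sigma> \<in> F - E" for \<sigma>
  proof -
    obtain A where A: "A \<in> U" "A \<subseteq> pgraph n \<sigma>" "card A \<le> q"
      using \<sigma> unfolding E_def B_def by force
    then obtain C where C: "C \<in> T \<union> (\<Union>l\<in>{2<..q}. W l)" "C \<subseteq> A" using TW(4) by blast
    have "\<sigma> \<notin> V" using \<sigma> unfolding E_def by auto
    moreover have "\<sigma> \<in> perms_with n C {}" using \<sigma> F A C unfolding perms_with_def by auto
    ultimately have "C \<in> T" using C unfolding V_def by blast
    then show ?thesis using A C by auto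
  qed
  moreover have "E \<subseteq> F" unfolding E_def B_def by auto
  ultimately show thesis using that[of T E] TW(1,2) cE by auto
qed

section \<open>Counting in the triangle case\<close>

lemma extend_partial_perm:
  assumes xy: "{x, y} \<in> partial_perms n" "x \<noteq> y" and xz: "{x, z} \<in> partial_perms n" "x \<noteq> z"
    and yz: "{y, z} \<in> partial_perms n"
  shows "{x, y, z} \<in> partial_perms n"
proof -
  obtain \<tau> where \<tau>: "\<tau> \<in> Sym n" "{y, z} \<subseteq> pgraph n \<tau>" using yz unfolding partial_perms_def by auto
  have perm: "\<tau> permutes {1..n}" using \<tau> unfolding Sym_def by simp
  obtain i j where x: "x = (i, j)" by (cases x)
  have ij: "i \<in> {1..n}" "j \<in> {1..n}" using partial_perms_subset_board[OF xy(1)] x by auto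
  define i' where "i' = Hilbert_Choice.inv \<tau> j"
  have i': "\<tau> i' = j" "i' \<in> {1..n}" unfolding i'_def
    using permutes_inverses(1)[OF perm] permutes_in_image[OF permutes_inv[OF perm]] ij by auto
  \<comment> \<open>Swapping rows \<open>i\<close> and \<open>i'\<close> puts \<open>x\<close> on
    the permutation. The points \<open>y\<close> and \<open>z\<close> stay: they share neither row
    nor column with \<open>x\<close>, so they lie in neither swapped row.\<close>
  let ?\<rho> = "\<tau> \<circ> transpose i i'"
  have "?\<rho> \<in> Sym n" using permutes_compose[OF permutes_swap_id[OF ij(1) i'(2)] perm]
    unfolding Sym_def by simp
  moreover have "w \<in> pgraph n ?\<rho>" if w: "w \<in> {y, z}" for w
  proof -
    have xw: "{x, w} \<in> partial_perms n" "x \<noteq> w" using w xy xz by auto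
    have t: "w \<in> pgraph n \<tau>" using \<tau> w by blast
    have "fst w \<noteq> i" "snd w \<noteq> j"
      using partial_perms_inj[OF xw(1)] xw(2) x by (auto simp: inj_on_def)
    moreover have "fst w \<noteq> i'" using t \<open>snd w \<noteq> j\<close> i' by auto
    ultimately show ?thesis using t by simp
  qed
  moreover have "x \<in> pgraph n ?\<rho>" using x ij i' by simp
  ultimately show ?thesis unfolding partial_perms_def by blast
qed

text \<open>Outside \<open>E\<close>, a member missing \<open>x\<close> passes through
  \<open>y\<close> and \<open>z\<close> and must still meet \<open>\<sigma>\<close>, which avoids
  both; at most \<open>3/4\<close> of the permutations through \<open>y, z\<close> do so. Together
  with \<open>E\<close> this gives \<open>3/4 + 1/5 = 19/20\<close>.\<close>

lemma card_missing_point_le: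
  assumes n: "500 \<le> n" and F: "F \<subseteq> Sym n" "meeting (pgraph n ` F)"
    and E: "E \<subseteq> F" "5 * card E \<le> fact (n - 2)"
    and yz: "{y, z} \<in> partial_perms n" "y \<noteq> z"
    and core: "\<And>\<sigma>. \<sigma> \<in> F - E \<Longrightarrow> x \<notin> pgraph n \<sigma> \<Longrightarrow> {y, z} \<subseteq> pgraph n \<sigma>"
    and \<sigma>: "\<sigma> \<in> F" "y \<notin> pgraph n \<sigma>" "z \<notin> pgraph n \<sigma>"
  shows "20 * card {\<pi> \<in> F. x \<notin> pgraph n \<pi>} \<le> 19 * fact (n - 2)"
proof -
  let ?H = "{\<pi> \<in> perms_with n {y, z} {}. pgraph n \<pi> \<inter> pgraph n \<sigma> \<noteq> {}}"
  have finF: "finite F" using F finite_Sym finite_subset by blast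
  have "{\<pi> \<in> F. x \<notin> pgraph n \<pi>} \<subseteq> E \<union> ?H"
    using core F \<sigma>(1) unfolding perms_with_def meeting_def by blast
  then have "card {\<pi> \<in> F. x \<notin> pgraph n \<pi>} \<le> card (E \<union> ?H)"
    using finite_subset[OF E(1) finF] by (intro card_mono) auto
  also have "\<dots> \<le> card E + card ?H" by (rule card_Un_le)
  finally have 1: "card {\<pi> \<in> F. x \<notin> pgraph n \<pi>} \<le> card E + card ?H" .
  have "4 * card ?H \<le> 3 * card (perms_with n {y, z} {})"
    using n F \<sigma> yz by (intro card_hit_le[where q = 2 and d = 0])
      (auto simp: degree_le_def pgraph_partial_perms subset_iff)
  also have "card (perms_with n {y, z} {}) = fact (n - 2)"
    using card_perms_with[OF yz(1)] yz(2) by (simp add: numeral_2_eq_2)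
  finally show ?thesis using 1 E(2) by linarith
qed

lemma diversity_le:
  assumes "x \<in> {1..n} \<times> {1..n}"
  shows "diversity n F \<le> card {\<sigma> \<in> F. x \<notin> pgraph n \<sigma>}"
proof -
  obtain i j where x: "x = (i, j)" "i \<in> {1..n}" "j \<in> {1..n}" using assms by auto
  have "{\<sigma> \<in> F. x \<notin> pgraph n \<sigma>} = {\<sigma> \<in> F. \<sigma> i \<noteq> j}" using x by auto
  then show ?thesis unfolding diversity_def using x by (intro Min_le) force+
qed

theorem theorem1p4:
  fixes n :: nat and \<F> :: "(nat \<Rightarrow> nat) set"
  assumes "n \<ge> 500"
    and "\<F> \<subseteq> Sym n"
    and "intersecting n \<F>"
  shows "diversity n \<F> \<le> (n - 3) * fact (n - 3)"
proof -
  let ?b = "(n - 3) * fact (n - 3) :: nat"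
  have "pgraph n \<sigma> \<inter> pgraph n \<pi> \<noteq> {}" if h: "\<sigma> \<in> \<F>" "\<pi> \<in> \<F>" for \<sigma> \<pi>
  proof -
    obtain i where "i \<in> {1..n}" "\<sigma> i = \<pi> i" using assms(3) h unfolding intersecting_def by blast
    then have "(i, \<sigma> i) \<in> pgraph n \<sigma> \<inter> pgraph n \<pi>" by simp
    then show ?thesis by blast
  qed
  then have meet: "meeting (pgraph n ` \<F>)" unfolding meeting_def by blast
  \<comment> \<open>The bound is \<open>fact (n - 2) - fact (n - 3)\<close>: the number of
    permutations through two points of a triangle but not the third.\<close>
  have fact2: "(fact (n - 2) :: nat) = ?b + fact (n - 3)"
  proof -
    have "(fact (n - 2) :: nat) = (n - 2) * fact (n - 2 - 1)" using assms(1) by (subst fact_reduce) auto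
    moreover have "n - 2 - 1 = n - 3" "n - 2 = n - 3 + 1" using assms(1) by auto
    ultimately show ?thesis by (simp add: algebra_simps)
  qed
  have "497 * fact (n - 3) \<le> ?b" using assms(1) by (intro mult_right_mono) auto
  then have b: "19 * fact (n - 2) \<le> 20 * ?b" using fact2 by linarith
  obtain T E where T: "T \<subseteq> partial_perms n" "\<And>A. A \<in> T \<Longrightarrow> card A \<le> 2" "meeting T"
    and E: "E \<subseteq> \<F>" "5 * card E \<le> fact (n - 2)"
    and core: "\<And>\<sigma>. \<sigma> \<in> \<F> - E \<Longrightarrow> \<exists>A\<in>T. A \<subseteq> pgraph n \<sigma>"
    using two_element_core[OF assms(1,2) meet] by metis
  have finF: "finite \<F>" using assms(2) finite_Sym finite_subset by blast
  have finE: "finite E" using E finF finite_subset by blast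
  have fin: "\<forall>A\<in>T. finite A \<and> card A \<le> 2" using T partial_perms_finite by auto
  have "\<exists>x\<in>{1..n} \<times> {1..n}. card {\<sigma> \<in> \<F>. x \<notin> pgraph n \<sigma>} \<le> ?b"
  proof (cases rule: meeting_pairs_cases[OF T(3) fin])
    case point: (1 x)
    \<comment> \<open>If \<open>T\<close> is empty, the common point \<open>x\<close> is arbitrary
      and may lie off the board; \<open>(1, 1)\<close> then takes its place.\<close>
    obtain x' where x': "x' \<in> {1..n} \<times> {1..n}" "\<And>A. A \<in> T \<Longrightarrow> x' \<in> A"
    proof (cases "T = {}")
      case True
      then show thesis using that[of "(1, 1)"] assms(1) by auto
    next
      case False
      then obtain A where "A \<in> T" by auto
      then have "x \<in> {1..n} \<times> {1..n}" using point T(1) partial_perms_subset_board by blast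
      then show thesis using that point by blast
    qed
    have "{\<sigma> \<in> \<F>. x' \<notin> pgraph n \<sigma>} \<subseteq> E" using core x'(2) by blast
    then have "card {\<sigma> \<in> \<F>. x' \<notin> pgraph n \<sigma>} \<le> card E" using finE by (intro card_mono)
    also have "\<dots> \<le> ?b" using E(2) b by linarith
    finally show ?thesis using x'(1) by blast
  next
    case triangle: (2 x y z)
    have P: "{x, y} \<in> partial_perms n" "{y, z} \<in> partial_perms n" "{x, z} \<in> partial_perms n"
      using triangle T(1) by blast+
    have board: "x \<in> {1..n} \<times> {1..n}" "y \<in> {1..n} \<times> {1..n}" "z \<in> {1..n} \<times> {1..n}"
      using P[THEN partial_perms_subset_board] by auto
    let ?two = "\<lambda>\<sigma>. {x, y} \<subseteq> pgraph n \<sigma> \<or> {y, z} \<subseteq> pgraph n \<sigma> \<or> {x, z} \<subseteq> pgraph n \<sigma>"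
    have two: "?two \<sigma>" if "\<sigma> \<in> \<F> - E" for \<sigma> using core[OF that] triangle(7) by blast
    show ?thesis
    proof (cases "\<forall>\<sigma>\<in>\<F>. ?two \<sigma>")
      case True
      \<comment> \<open>A member missing \<open>x\<close> must contain the other two points, so the
        count is exact and \<open>E\<close> does not enter.\<close>
      then have "{\<sigma> \<in> \<F>. x \<notin> pgraph n \<sigma>} \<subseteq> perms_with n {y, z} {x}"
        using assms(2) unfolding perms_with_def by blast
      then have "card {\<sigma> \<in> \<F>. x \<notin> pgraph n \<sigma>} \<le> card (perms_with n {y, z} {x})"
        by (intro card_mono) auto
      also have "\<dots> = card (perms_with n {y, z} {}) - card (perms_with n {x, y, z} {})"
        unfolding perms_with_insert_right
        by (intro card_Diff_subset finite_perms_with perms_with_insert_left_subset)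
      also have "\<dots> = fact (n - 2) - fact (n - 3)"
        using card_perms_with[OF P(2)] triangle
          card_perms_with[OF extend_partial_perm[OF P(1) _ P(3) _ P(2)]]
        by (simp add: numeral_2_eq_2 numeral_3_eq_3)
      also have "\<dots> = ?b" using fact2 by simp
      finally show ?thesis using board by blast
    next
      case False
      then obtain \<sigma> where \<sigma>: "\<sigma> \<in> \<F>" "\<not> ?two \<sigma>" by auto
      note le = card_missing_point_le[OF assms(1,2) meet E _ _ _ \<sigma>(1)]
      \<comment> \<open>Containing no pair, \<open>\<sigma>\<close> misses at least two of the three
        points; the remaining point is the one at which the diversity is bounded.\<close>
      from \<sigma>(2) consider "y \<notin> pgraph n \<sigma>" "z \<notin> pgraph n \<sigma>" | "x \<notin> pgraph n \<sigma>" "z \<notin> pgraph n \<sigma>"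
        | "x \<notin> pgraph n \<sigma>" "y \<notin> pgraph n \<sigma>" by blast
      then have "\<exists>w\<in>{x, y, z}. 20 * card {\<pi> \<in> \<F>. w \<notin> pgraph n \<pi>} \<le> 19 * fact (n - 2)"
      proof cases
        case 1
        have "20 * card {\<pi> \<in> \<F>. x \<notin> pgraph n \<pi>} \<le> 19 * fact (n - 2)"
          by (rule le[OF P(2) triangle(2) _ 1]) (use two in blast)
        then show ?thesis by blast
      next
        case 2
        have "20 * card {\<pi> \<in> \<F>. y \<notin> pgraph n \<pi>} \<le> 19 * fact (n - 2)"
          by (rule le[OF P(3) triangle(3) _ 2]) (use two in blast)
        then show ?thesis by blast
      next
        case 3
        have "20 * card {\<pi> \<in> \<F>. z \<notin> pgraph n \<pi>} \<le> 19 * fact (n - 2)"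
          by (rule le[OF P(1) triangle(1) _ 3]) (use two in blast)
        then show ?thesis by blast
      qed
      then obtain w where w: "w \<in> {x, y, z}"
        "20 * card {\<pi> \<in> \<F>. w \<notin> pgraph n \<pi>} \<le> 19 * fact (n - 2)" by blast
      have "card {\<pi> \<in> \<F>. w \<notin> pgraph n \<pi>} \<le> ?b" using w(2) b by linarith
      then show ?thesis using w(1) board by blast
    qed
  qed
  then obtain x where "x \<in> {1..n} \<times> {1..n}" "card {\<sigma> \<in> \<F>. x \<notin> pgraph n \<sigma>} \<le> ?b" by blast
  then show ?thesis using diversity_le[of x n \<F>] by linarith
qed

end
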